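(* The reduction relation $\rightarrow_{\beta\pi\sigma\mu}$ of $\lambda\mathbf{J}^{\mathbf{ms}}$ is confluent.
   Context: $\lambda\mathbf{J}^{\mathbf{ms}}$: terms $t,u,v::=x\mid\lambda x.t\mid t\,l$; co-terms $l::=u::l\mid(x)v$ ($(x)$ binds $x$ in $v$; capture-avoiding substitution $[t/x]$). A value $V$ is a variable or a $\lambda$-abstraction. Append: $(u::l)@l'=u::(l@l')$, $((x)V)@l'=(x)(V\,l')$ for $V$ a value, $((x)t\,l)@l'=(x)t\,(l@l')$. The reduction is the closure under all constructors of: $(\beta)\ (\lambda x.t)(u::l)\rightarrow u((x)t\,l)$; $(\sigma)\ t(x)v\rightarrow[t/x]v$; $(\pi)\ (t\,l)(u::l')\rightarrow t\,(l@(u::l'))$; $(\mu)\ (x)x\,l\rightarrow l$ if $x$ not free in $l$. Confluence: whenever $t\rightarrow^*t_1$ and $t\rightarrow^*t_2$ there is $t_3$ with $t_i\rightarrow^*t_3$, $i=1,2$. *)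

theory Defs
  imports "HOL-Library.Confluence"
begin

text \<open>Expressions are taken up to renaming of bound variables, using de Bruijn indices;
  \<open>Lam\<close> and \<open>Sel\<close> (for \<open>(x)v\<close>) bind index \<open>0\<close> in their argument.\<close>

datatype tm = Var nat | Lam tm | App tm co
  and co = Cons tm co | Sel tm

primrec lift_tm :: "tm \<Rightarrow> nat \<Rightarrow> tm" and lift_co :: "co \<Rightarrow> nat \<Rightarrow> co" where
  "lift_tm (Var i) k = (if i < k then Var i else Var (Suc i))"
| "lift_tm (Lam t) k = Lam (lift_tm t (Suc k))"
| "lift_tm (App t l) k = App (lift_tm t k) (lift_co l k)"
| "lift_co (Cons u l) k = Cons (lift_tm u k) (lift_co l k)"
| "lift_co (Sel v) k = Sel (lift_tm v (Suc k))"

text \<open>\<open>subst_tm v s k\<close> replaces index \<open>k\<close> by \<open>s\<close> and removes the binder of \<open>k\<close>, so the indices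
  above \<open>k\<close> are decremented. Hence \<open>[t/x]v\<close>, for a body \<open>v\<close> of \<open>(x)v\<close>, is \<open>subst_tm v t 0\<close>.\<close>

primrec subst_tm :: "tm \<Rightarrow> tm \<Rightarrow> nat \<Rightarrow> tm" and subst_co :: "co \<Rightarrow> tm \<Rightarrow> nat \<Rightarrow> co" where
  "subst_tm (Var i) s k = (if k < i then Var (i - 1) else if i = k then s else Var i)"
| "subst_tm (Lam t) s k = Lam (subst_tm t (lift_tm s 0) (Suc k))"
| "subst_tm (App t l) s k = App (subst_tm t s k) (subst_co l s k)"
| "subst_co (Cons u l) s k = Cons (subst_tm u s k) (subst_co l s k)"
| "subst_co (Sel v) s k = Sel (subst_tm v (lift_tm s 0) (Suc k))"

text \<open>The second and third equations are the two forms of a value \<open>V\<close> in \<open>((x)V)@l' = (x)(V l')\<close>.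
  Lifting \<open>l'\<close> expresses that \<open>x\<close> is chosen not free in \<open>l'\<close>.\<close>

fun append_co :: "co \<Rightarrow> co \<Rightarrow> co" where
  "append_co (Cons u l) l' = Cons u (append_co l l')"
| "append_co (Sel (Var i)) l' = Sel (App (Var i) (lift_co l' 0))"
| "append_co (Sel (Lam t)) l' = Sel (App (Lam t) (lift_co l' 0))"
| "append_co (Sel (App t l)) l' = Sel (App t (append_co l (lift_co l' 0)))"

text \<open>In \<open>beta\<close> the variable bound by the abstraction becomes the one bound by \<open>(x)\<close>, with
  \<open>x\<close> not free in \<open>l\<close>. In \<open>mu\<close> the side condition that \<open>x\<close> is not free holds exactly
  when the co-term under the binder has the form \<open>lift_co l 0\<close>.\<close>

inductive red_tm :: "tm \<Rightarrow> tm \<Rightarrow> bool" and red_co :: "co \<Rightarrow> co \<Rightarrow> bool" where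
  beta: "red_tm (App (Lam t) (Cons u l)) (App u (Sel (App t (lift_co l 0))))"
| sigma: "red_tm (App t (Sel v)) (subst_tm v t 0)"
| pi: "red_tm (App (App t l) (Cons u l')) (App t (append_co l (Cons u l')))"
| mu: "red_co (Sel (App (Var 0) (lift_co l 0))) l"
| Lam: "red_tm t t' \<Longrightarrow> red_tm (Lam t) (Lam t')"
| App1: "red_tm t t' \<Longrightarrow> red_tm (App t l) (App t' l)"
| App2: "red_co l l' \<Longrightarrow> red_tm (App t l) (App t l')"
| Cons1: "red_tm u u' \<Longrightarrow> red_co (Cons u l) (Cons u' l)"
| Cons2: "red_co l l' \<Longrightarrow> red_co (Cons u l) (Cons u l')"
| Sel: "red_tm v v' \<Longrightarrow> red_co (Sel v) (Sel v')"

end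

theory Submission
  imports Defs
begin

text \<open>Every expression has a normal form for \<open>\<sigma>\<close> and \<open>\<pi>\<close> together, computed by structural
  recursion: substitution into a normal form creates \<open>\<pi>\<close>-redexes but no \<open>\<sigma>\<close>-redexes, and the
  former are removed by an application that appends on the fly. A \<open>\<sigma>\<close>- or \<open>\<pi>\<close>-step does not change
  the normal form, while a \<open>\<beta>\<close>- or \<open>\<mu>\<close>-step becomes a step of a parallel reduction on normal forms.
  The parallel reduction has the triangle property of Takahashi and is contained in many-step
  reduction, so confluence transfers back.\<close>

section \<open>Flattened application and substitution\<close>

text \<open>Flattening is a reduction only when \<open>m\<close> is a \<open>Cons\<close>, but its algebraic laws hold for all \<open>m\<close>.\<close>

fun flat_app :: "tm \<Rightarrow> co \<Rightarrow> tm" where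
  "flat_app (App t l) m = App t (append_co l m)"
| "flat_app (Var i) m = App (Var i) m"
| "flat_app (Lam t) m = App (Lam t) m"

text \<open>Merges the three clauses for \<open>Sel\<close>, which then leave the simplifier, so
  that later proofs need no cases on the body.\<close>

lemma append_co_Sel: "append_co (Sel v) m = Sel (flat_app v (lift_co m 0))"
  by (cases v) auto

declare append_co.simps(2-4) [simp del]
declare append_co_Sel [simp]

section \<open>Lifting and associativity of flattening\<close>

lemma lift_lift:
  "i \<le> k \<Longrightarrow> lift_tm (lift_tm t i) (Suc k) = lift_tm (lift_tm t k) i"
  "i \<le> k \<Longrightarrow> lift_co (lift_co l i) (Suc k) = lift_co (lift_co l k) i"
  by (induction t and l arbitrary: i k and i k) auto

lemma lift_flat_app_append:
  "lift_tm (flat_app t m) k = flat_app (lift_tm t k) (lift_co m k)"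
  "lift_co (append_co l m) k = append_co (lift_co l k) (lift_co m k)"
  by (induction t and l arbitrary: m k and m k) (auto simp: lift_lift)

lemma flat_app_append_assoc:
  "flat_app (flat_app t l) m = flat_app t (append_co l m)"
  "append_co (append_co l' l) m = append_co l' (append_co l m)"
  by (induction t and l' arbitrary: l m and l m) (auto simp: lift_flat_app_append)

text \<open>Differs from \<open>subst_tm\<close> only at \<open>App\<close>, where an application
  put in head position would form a \<pi>-redex. Flattening triggers no further substitution, so
  recursion on the body suffices.\<close>

primrec flat_subst_tm :: "tm \<Rightarrow> tm \<Rightarrow> nat \<Rightarrow> tm"
  and flat_subst_co :: "co \<Rightarrow> tm \<Rightarrow> nat \<Rightarrow> co" where
  "flat_subst_tm (Var i) s k = (if k < i then Var (i - 1) else if i = k then s else Var i)"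
| "flat_subst_tm (Lam t) s k = Lam (flat_subst_tm t (lift_tm s 0) (Suc k))"
| "flat_subst_tm (App t l) s k = flat_app (flat_subst_tm t s k) (flat_subst_co l s k)"
| "flat_subst_co (Cons u l) s k = Cons (flat_subst_tm u s k) (flat_subst_co l s k)"
| "flat_subst_co (Sel v) s k = Sel (flat_subst_tm v (lift_tm s 0) (Suc k))"

lemma lift_flat_subst_le:
  "i \<le> k \<Longrightarrow> lift_tm (flat_subst_tm t s k) i = flat_subst_tm (lift_tm t i) (lift_tm s i) (Suc k)"
  "i \<le> k \<Longrightarrow> lift_co (flat_subst_co l s k) i = flat_subst_co (lift_co l i) (lift_tm s i) (Suc k)"
  by (induction t and l arbitrary: s i k and s i k) (auto simp: lift_lift lift_flat_app_append)

lemma lift_flat_subst_ge: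
  "k \<le> i \<Longrightarrow> lift_tm (flat_subst_tm t s k) i = flat_subst_tm (lift_tm t (Suc i)) (lift_tm s i) k"
  "k \<le> i \<Longrightarrow> lift_co (flat_subst_co l s k) i = flat_subst_co (lift_co l (Suc i)) (lift_tm s i) k"
  by (induction t and l arbitrary: s i k and s i k) (auto simp: lift_lift lift_flat_app_append)

text \<open>For an application \<open>t\<close> both sides flatten the same three pieces, bracketed
  differently.\<close>

lemma flat_subst_flat_app_append:
  "flat_subst_tm (flat_app t m) s k = flat_app (flat_subst_tm t s k) (flat_subst_co m s k)"
  "flat_subst_co (append_co l m) s k = append_co (flat_subst_co l s k) (flat_subst_co m s k)"
  by (induction t and l arbitrary: m s k and m s k)
    (auto simp: flat_app_append_assoc lift_flat_subst_le)

section \<open>Normal forms for \<sigma> and \<pi> as a predicate\<close>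

fun is_Cons :: "co \<Rightarrow> bool" where
  "is_Cons (Cons u l) = True"
| "is_Cons (Sel v) = False"

fun is_val :: "tm \<Rightarrow> bool" where
  "is_val (App t l) = False"
| "is_val _ = True"

text \<open>The condition at \<open>App\<close> excludes applied applications (\<pi>) and
  \<open>Sel\<close> arguments (\<sigma>); \<beta>- and \<mu>-redexes remain allowed.\<close>

primrec nf_tm :: "tm \<Rightarrow> bool" and nf_co :: "co \<Rightarrow> bool" where
  "nf_tm (Var i) = True"
| "nf_tm (Lam t) = nf_tm t"
| "nf_tm (App t l) = (is_val t \<and> is_Cons l \<and> nf_tm t \<and> nf_co l)"
| "nf_co (Cons u l) = (nf_tm u \<and> nf_co l)"
| "nf_co (Sel v) = nf_tm v"

lemma is_Cons_lift [simp]: "is_Cons (lift_co l k) = is_Cons l"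
  by (cases l) auto

lemma is_Cons_append [simp]: "is_Cons (append_co l m) = is_Cons l"
  by (cases l) auto

lemma is_Cons_flat_subst [simp]: "is_Cons (flat_subst_co l s k) = is_Cons l"
  by (cases l) auto

lemma is_val_lift [simp]: "is_val (lift_tm t k) = is_val t"
  by (cases t) auto

lemma flat_app_val: "is_val t \<Longrightarrow> flat_app t m = App t m"
  by (cases t) auto

lemma nf_lift [simp]:
  "nf_tm (lift_tm t k) = nf_tm t"
  "nf_co (lift_co l k) = nf_co l"
  by (induction t and l arbitrary: k and k) auto

lemma nf_flat_app_append:
  "nf_tm t \<Longrightarrow> nf_co m \<Longrightarrow> is_Cons m \<Longrightarrow> nf_tm (flat_app t m)"
  "nf_co l \<Longrightarrow> nf_co m \<Longrightarrow> is_Cons m \<Longrightarrow> nf_co (append_co l m)"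
  by (induction t and l arbitrary: m and m) auto

lemma nf_flat_subst:
  "nf_tm t \<Longrightarrow> nf_tm s \<Longrightarrow> nf_tm (flat_subst_tm t s k)"
  "nf_co l \<Longrightarrow> nf_tm s \<Longrightarrow> nf_co (flat_subst_co l s k)"
  by (induction t and l arbitrary: s k and s k) (auto simp: nf_flat_app_append)

text \<open>\<open>flat_subst_tm\<close> flattens even where the index does not occur; a normal form
  leaves nothing to flatten.\<close>

lemma flat_subst_lift:
  "nf_tm t \<Longrightarrow> flat_subst_tm (lift_tm t k) s k = t"
  "nf_co l \<Longrightarrow> flat_subst_co (lift_co l k) s k = l"
  by (induction t and l arbitrary: s k and s k) (auto simp: flat_app_val)

text \<open>Serves \<mu>-redexes whose inner co-term is a \<open>Sel\<close>: their body is a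
  \<sigma>-redex that merely renames a variable.\<close>

lemma flat_subst_Var_lift:
  "nf_tm t \<Longrightarrow> flat_subst_tm (lift_tm t (Suc k)) (Var k) k = t"
  "nf_co l \<Longrightarrow> flat_subst_co (lift_co l (Suc k)) (Var k) k = l"
  by (induction t and l arbitrary: k and k) (auto simp: flat_app_val)

text \<open>Normality of \<open>s\<close> enters at the variable replaced by \<open>s\<close>: there
  the right side substitutes into a lifted \<open>s\<close> and must return
  \<open>s\<close>.\<close>

lemma flat_subst_flat_subst:
  "i \<le> k \<Longrightarrow> nf_tm s \<Longrightarrow> flat_subst_tm (flat_subst_tm v t i) s k =
     flat_subst_tm (flat_subst_tm v (lift_tm s i) (Suc k)) (flat_subst_tm t s k) i"
  "i \<le> k \<Longrightarrow> nf_tm s \<Longrightarrow> flat_subst_co (flat_subst_co l t i) s k =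
     flat_subst_co (flat_subst_co l (lift_tm s i) (Suc k)) (flat_subst_tm t s k) i"
  by (induction v and l arbitrary: t s i k and t s i k)
    (auto simp: flat_subst_lift flat_subst_flat_app_append lift_lift lift_flat_subst_le)

section \<open>Normal forms for \<sigma> and \<pi>\<close>

fun nf_app :: "tm \<Rightarrow> co \<Rightarrow> tm" where
  "nf_app t (Cons u l) = flat_app t (Cons u l)"
| "nf_app t (Sel v) = flat_subst_tm v t 0"

primrec norm_tm :: "tm \<Rightarrow> tm" and norm_co :: "co \<Rightarrow> co" where
  "norm_tm (Var i) = Var i"
| "norm_tm (Lam t) = Lam (norm_tm t)"
| "norm_tm (App t l) = nf_app (norm_tm t) (norm_co l)"
| "norm_co (Cons u l) = Cons (norm_tm u) (norm_co l)"
| "norm_co (Sel v) = Sel (norm_tm v)"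

lemma nf_app_Cons: "is_Cons l \<Longrightarrow> nf_app t l = flat_app t l"
  by (cases l) auto

lemma lift_nf_app: "lift_tm (nf_app t l) k = nf_app (lift_tm t k) (lift_co l k)"
  by (cases l) (auto simp: lift_flat_app_append lift_flat_subst_ge)

lemma flat_subst_nf_app:
  "nf_tm s \<Longrightarrow> flat_subst_tm (nf_app t l) s k = nf_app (flat_subst_tm t s k) (flat_subst_co l s k)"
  by (cases l) (auto simp: flat_subst_flat_app_append flat_subst_flat_subst)

text \<open>Invariance under \<pi>. For a \<open>Cons\<close> it is associativity; for a
  \<open>Sel\<close>, \<open>m\<close> sits lifted under the binder and the substitution undoes the
  lifting.\<close>

lemma nf_app_append:
  "nf_co m \<Longrightarrow> is_Cons m \<Longrightarrow> nf_app t (append_co l m) = flat_app (nf_app t l) m"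
  by (cases l) (auto simp: flat_subst_flat_app_append flat_app_append_assoc flat_subst_lift)

lemma nf_nf_app: "nf_tm t \<Longrightarrow> nf_co l \<Longrightarrow> nf_tm (nf_app t l)"
  by (cases l) (auto simp: nf_flat_app_append nf_flat_subst)

lemma nf_norm [simp]: "nf_tm (norm_tm t)" "nf_co (norm_co l)"
  by (induction t and l) (auto simp: nf_nf_app)

lemma norm_lift:
  "norm_tm (lift_tm t k) = lift_tm (norm_tm t) k"
  "norm_co (lift_co l k) = lift_co (norm_co l) k"
  by (induction t and l arbitrary: k and k) (auto simp: lift_nf_app)

lemma norm_subst:
  "norm_tm (subst_tm t s k) = flat_subst_tm (norm_tm t) (norm_tm s) k"
  "norm_co (subst_co l s k) = flat_subst_co (norm_co l) (norm_tm s) k"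
  by (induction t and l arbitrary: s k and s k) (auto simp: flat_subst_nf_app norm_lift)

lemma is_Cons_norm [simp]: "is_Cons (norm_co l) = is_Cons l"
  by (cases l) auto

text \<open>With \<open>m\<close> a \<open>Sel\<close>, normalisation could contract the application
  that flattening builds, and the sides would differ.\<close>

lemma norm_flat_app_append:
  "is_Cons m \<Longrightarrow> norm_tm (flat_app t m) = flat_app (norm_tm t) (norm_co m)"
  "is_Cons m \<Longrightarrow> norm_co (append_co l m) = append_co (norm_co l) (norm_co m)"
  by (induction t and l arbitrary: m and m) (auto simp: norm_lift nf_app_append nf_app_Cons)

section \<open>Parallel reduction on normal forms\<close>

text \<open>The side conditions keep left-hand sides normal. The reduct in \<open>beta\<close> is
  the normal form of u'((x)t' l'), as substituting for x does not affect l'.\<close>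

inductive par_tm :: "tm \<Rightarrow> tm \<Rightarrow> bool" and par_co :: "co \<Rightarrow> co \<Rightarrow> bool" where
  Var: "par_tm (Var i) (Var i)"
| Lam: "par_tm t t' \<Longrightarrow> par_tm (Lam t) (Lam t')"
| App: "par_tm t t' \<Longrightarrow> par_co l l' \<Longrightarrow> is_val t \<Longrightarrow> is_Cons l \<Longrightarrow> par_tm (App t l) (App t' l')"
| beta: "par_tm t t' \<Longrightarrow> par_tm u u' \<Longrightarrow> par_co l l' \<Longrightarrow>
    par_tm (App (Lam t) (Cons u l)) (nf_app (flat_subst_tm t' u' 0) l')"
| Cons: "par_tm u u' \<Longrightarrow> par_co l l' \<Longrightarrow> par_co (Cons u l) (Cons u' l')"
| Sel: "par_tm v v' \<Longrightarrow> par_co (Sel v) (Sel v')"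
| mu: "par_co l l' \<Longrightarrow> is_Cons l \<Longrightarrow> par_co (Sel (App (Var 0) (lift_co l 0))) l'"

section \<open>Compatibility of parallel reduction with lifting, flattening and substitution\<close>

inductive_cases par_VarE: "par_tm (Var i) b"
inductive_cases par_LamE: "par_tm (Lam t) b"
inductive_cases par_AppE: "par_tm (App t l) b"
inductive_cases par_ConsE: "par_co (Cons u l) b"
inductive_cases par_SelE: "par_co (Sel v) b"

lemma par_is_Cons: "par_co l l' \<Longrightarrow> is_Cons l \<Longrightarrow> is_Cons l'"
  by (cases l) (auto elim: par_ConsE)

lemma par_is_val: "par_tm t t' \<Longrightarrow> is_val t \<Longrightarrow> is_val t'"
  by (cases t) (auto elim: par_VarE par_LamE)

lemma par_refl:
  "nf_tm t \<Longrightarrow> par_tm t t"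
  "nf_co l \<Longrightarrow> par_co l l"
  by (induction t and l) (auto intro: par_tm_par_co.intros)

lemma par_nf:
  "par_tm t t' \<Longrightarrow> nf_tm t \<and> nf_tm t'"
  "par_co l l' \<Longrightarrow> nf_co l \<and> nf_co l'"
  by (induction rule: par_tm_par_co.inducts)
    (auto simp: nf_flat_subst nf_nf_app dest: par_is_Cons par_is_val)

lemma par_lift:
  "par_tm t t' \<Longrightarrow> par_tm (lift_tm t k) (lift_tm t' k)"
  "par_co l l' \<Longrightarrow> par_co (lift_co l k) (lift_co l' k)"
proof (induction arbitrary: k and k rule: par_tm_par_co.inducts)
  case (mu l l')
  then show ?case by (auto simp: lift_lift intro!: par_tm_par_co.mu)
qed (auto simp: lift_nf_app lift_flat_subst_ge intro: par_tm_par_co.intros)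

lemma par_flat_app_append:
  "par_tm t t' \<Longrightarrow> par_co m m' \<Longrightarrow> is_Cons m \<Longrightarrow> par_tm (flat_app t m) (flat_app t' m')"
  "par_co l l' \<Longrightarrow> par_co m m' \<Longrightarrow> is_Cons m \<Longrightarrow> par_co (append_co l m) (append_co l' m')"
proof (induction arbitrary: m m' and m m' rule: par_tm_par_co.inducts)
  case (App t t' l l')
  then show ?case
    by (cases t; cases t') (auto dest: par_is_val intro: par_tm_par_co.intros)
next
  case (beta t t' u u' l l')
  have "nf_co m'" "is_Cons m'"
    using beta.prems par_nf par_is_Cons by auto
  \<comment> \<open>Read backwards, \<open>nf_app_append\<close> moves \<open>m'\<close> into the
    co-term, giving the contractum of the \<beta>-redex with \<open>m\<close> appended.\<close>
  then show ?case
    using beta by (auto simp: nf_app_append[symmetric] intro!: par_tm_par_co.beta)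
next
  case (mu l l')
  \<comment> \<open>A lifted \<open>m\<close> is appended to a lifted co-term; the result is again a
    lifting, so the \<mu>-redex survives.\<close>
  then show ?case
    by (auto simp: lift_flat_app_append[symmetric] intro!: par_tm_par_co.mu)
next
  case (Sel v v')
  then show ?case by (simp add: par_tm_par_co.Sel par_lift)
qed (auto intro: par_tm_par_co.intros)

lemma par_flat_subst:
  "par_tm t t' \<Longrightarrow> par_tm s s' \<Longrightarrow> par_tm (flat_subst_tm t s k) (flat_subst_tm t' s' k)"
  "par_co l l' \<Longrightarrow> par_tm s s' \<Longrightarrow> par_co (flat_subst_co l s k) (flat_subst_co l' s' k)"
proof (induction arbitrary: s s' k and s s' k rule: par_tm_par_co.inducts)
  case (beta t t' u u' l l')
  have "nf_tm s'" using beta.prems par_nf by auto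
  then show ?case
    using beta
    by (auto simp: flat_subst_nf_app flat_subst_flat_subst intro!: par_tm_par_co.beta par_lift)
next
  case (mu l l')
  then show ?case
    by (auto simp: lift_flat_subst_le[symmetric] intro!: par_tm_par_co.mu)
next
  case (Lam t t')
  then show ?case by (simp add: par_tm_par_co.Lam par_lift)
next
  case (Sel v v')
  then show ?case by (simp add: par_tm_par_co.Sel par_lift)
qed (auto intro: par_tm_par_co.intros par_flat_app_append)

lemma par_nf_app:
  assumes t: "par_tm t t'" and l: "par_co l l'"
  shows "par_tm (nf_app t l) (nf_app t' l')"
  using l
proof cases
  case (mu m)
  \<comment> \<open>The overlap of \<sigma> and \<mu>: substituting \<open>t\<close> for the head
    variable leaves \<open>flat_app t m\<close>, and since \<open>l'\<close> is a
    \<open>Cons\<close>, the right side is a flattened application too.\<close>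
  have "nf_co m" "is_Cons l'"
    using mu par_nf par_is_Cons by auto
  with mu t show ?thesis
    by (auto simp: flat_subst_lift nf_app_Cons intro: par_flat_app_append)
qed (use t in \<open>auto intro: par_flat_app_append[of _ _ "Cons _ _" "Cons _ _", simplified]
  par_tm_par_co.intros par_flat_subst\<close>)

section \<open>Parallel reduction of lifted expressions\<close>

text \<open>Non-occurrence is expressed as being a lifting, so avoiding two indices must be turned
  into being a double lifting; \<mu> under an outer lifting requires this.\<close>

lemma lift_eq_lift:
  "i \<le> k \<Longrightarrow> lift_tm a (Suc k) = lift_tm b i \<Longrightarrow> \<exists>c. a = lift_tm c i \<and> b = lift_tm c k"
  "i \<le> k \<Longrightarrow> lift_co l (Suc k) = lift_co m i \<Longrightarrow> \<exists>n. l = lift_co n i \<and> m = lift_co n k"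
proof (induction a and l arbitrary: b i k and m i k)
  case (Var x)
  then obtain y where y: "b = Var y" by (cases b) (auto split: if_splits)
  show ?case
    using Var y by (intro exI[of _ "Var (if x < i then x else x - 1)"]) (auto split: if_splits)
next
  case (Lam t)
  then obtain s where s: "b = Lam s" by (cases b) (auto split: if_splits)
  with Lam.prems Lam.IH[of "Suc i" "Suc k" s] obtain c
    where "t = lift_tm c (Suc i)" "s = lift_tm c (Suc k)" by auto
  with s show ?case by (intro exI[of _ "Lam c"]) auto
next
  case (App t l)
  then obtain s n where s: "b = App s n" by (cases b) (auto split: if_splits)
  with App.prems App.IH(1)[of i k s] App.IH(2)[of i k n] obtain c d
    where "t = lift_tm c i" "s = lift_tm c k" "l = lift_co d i" "n = lift_co d k" by auto
  with s show ?case by (intro exI[of _ "App c d"]) auto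
next
  case (Cons t l)
  then obtain s n where s: "m = Cons s n" by (cases m) auto
  with Cons.prems Cons.IH(1)[of i k s] Cons.IH(2)[of i k n] obtain c d
    where "t = lift_tm c i" "s = lift_tm c k" "l = lift_co d i" "n = lift_co d k" by auto
  with s show ?case by (intro exI[of _ "Cons c d"]) auto
next
  case (Sel t)
  then obtain s where s: "m = Sel s" by (cases m) auto
  with Sel.prems Sel.IH[of "Suc i" "Suc k" s] obtain c
    where "t = lift_tm c (Suc i)" "s = lift_tm c (Suc k)" by auto
  with s show ?case by (intro exI[of _ "Sel c"]) auto
qed

lemma lift_eqD:
  "lift_tm t k = Var i \<Longrightarrow> \<exists>j. t = Var j \<and> (if j < k then j else Suc j) = i"
  "lift_tm t k = Lam b \<Longrightarrow> \<exists>a. t = Lam a \<and> lift_tm a (Suc k) = b"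
  "lift_tm t k = App b m \<Longrightarrow> \<exists>a l. t = App a l \<and> lift_tm a k = b \<and> lift_co l k = m"
  "lift_co l k = Cons b m \<Longrightarrow> \<exists>a n. l = Cons a n \<and> lift_tm a k = b \<and> lift_co n k = m"
  "lift_co l k = Sel b \<Longrightarrow> \<exists>a. l = Sel a \<and> lift_tm a (Suc k) = b"
  by (cases t; auto split: if_splits; fail)+ (cases l; auto)+

text \<open>Steps introduce no free variables, so the side condition of \<mu> survives reduction
  inside the redex.\<close>

lemma par_lift_left:
  "par_tm t0 b \<Longrightarrow> t0 = lift_tm t k \<Longrightarrow> \<exists>t'. b = lift_tm t' k \<and> par_tm t t'"
  "par_co l0 m \<Longrightarrow> l0 = lift_co l k \<Longrightarrow> \<exists>l'. m = lift_co l' k \<and> par_co l l'"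
proof (induction arbitrary: t k and l k rule: par_tm_par_co.inducts)
  case (Var i)
  from lift_eqD(1)[OF Var.prems[symmetric]] obtain j
    where "t = Var j" "(if j < k then j else Suc j) = i" by auto
  then show ?case
    by (intro exI[of _ "Var j"]) (auto intro: par_tm_par_co.Var)
next
  case (Lam a a')
  from lift_eqD(2)[OF Lam.prems[symmetric]] obtain c where "t = Lam c" "a = lift_tm c (Suc k)" by auto
  with Lam.IH[of c "Suc k"] show ?case
    by (metis lift_tm.simps(2) par_tm_par_co.Lam)
next
  case (App a a' l l')
  from lift_eqD(3)[OF App.prems[symmetric]] obtain c d
    where t: "t = App c d" "a = lift_tm c k" "l = lift_co d k" by auto
  with App.IH(1)[of c k] App.IH(2)[of d k] obtain c' d'
    where "a' = lift_tm c' k" "par_tm c c'" "l' = lift_co d' k" "par_co d d'" by auto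
  with t App.hyps show ?case
    by (intro exI[of _ "App c' d'"]) (auto intro: par_tm_par_co.App)
next
  case (beta a a' u u' l l')
  from beta.prems[symmetric] obtain c e d
    where t: "t = App (Lam c) (Cons e d)" "a = lift_tm c (Suc k)" "u = lift_tm e k" "l = lift_co d k"
    by (auto dest!: lift_eqD)
  with beta.IH(1)[of c "Suc k"] beta.IH(2)[of e k] beta.IH(3)[of d k] obtain c' e' d'
    where "a' = lift_tm c' (Suc k)" "par_tm c c'" "u' = lift_tm e' k" "par_tm e e'"
      "l' = lift_co d' k" "par_co d d'" by auto
  with t show ?case
    by (intro exI[of _ "nf_app (flat_subst_tm c' e' 0) d'"])
      (auto simp: lift_nf_app lift_flat_subst_ge intro: par_tm_par_co.beta)
next
  case (Cons u u' l0 l')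
  from lift_eqD(4)[OF Cons.prems[symmetric]] obtain c d
    where t: "l = Cons c d" "u = lift_tm c k" "l0 = lift_co d k" by auto
  with Cons.IH(1)[of c k] Cons.IH(2)[of d k] obtain c' d'
    where "u' = lift_tm c' k" "par_tm c c'" "l' = lift_co d' k" "par_co d d'" by auto
  with t show ?case
    by (intro exI[of _ "Cons c' d'"]) (auto intro: par_tm_par_co.Cons)
next
  case (Sel a a')
  from lift_eqD(5)[OF Sel.prems[symmetric]] obtain c where "l = Sel c" "a = lift_tm c (Suc k)" by auto
  with Sel.IH[of c "Suc k"] show ?case
    by (metis lift_co.simps(2) par_tm_par_co.Sel)
next
  case (mu m m')
  from mu.prems[symmetric] obtain c where l: "l = Sel (App (Var 0) c)"
    and "lift_co c (Suc k) = lift_co m 0"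
    by (auto dest!: lift_eqD split: if_splits)
  \<comment> \<open>The co-term avoids both the variable bound by \<open>Sel\<close> and index
    \<open>k\<close>, so the unlifted expression is a \<mu>-redex too.\<close>
  then obtain n where n: "c = lift_co n 0" "m = lift_co n k"
    using lift_eq_lift(2) by blast
  with mu.IH[of n k] obtain n' where "m' = lift_co n' k" "par_co n n'" by auto
  with l n mu.hyps show ?case
    by (auto intro: par_tm_par_co.mu)
qed

text \<open>Makes the contractum of a \<mu>-redex unique, although the redex contains it only
  lifted.\<close>

lemma lift_inject:
  "lift_tm a k = lift_tm b k \<Longrightarrow> a = b"
  "lift_co l k = lift_co m k \<Longrightarrow> l = m"
proof (induction a and l arbitrary: b k and m k)
  case (Var x)
  then show ?case by (cases b) (auto split: if_splits)
next
  case (Lam t)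
  then show ?case by (cases b) (auto split: if_splits)
next
  case (App t l)
  then show ?case by (cases b) (auto split: if_splits)
next
  case (Cons t l)
  then show ?case by (cases m) auto
next
  case (Sel t)
  then show ?case by (cases m) auto
qed

text \<open>In the case of \<open>Sel\<close> on a \<open>\<mu>\<close>-redex, the maximal reduct of the contractum is read off the one
  of the body, which still has the form of the body because it is itself a parallel reduct.\<close>

lemma par_triangle:
  "nf_tm t \<Longrightarrow> \<exists>d. \<forall>b. par_tm t b \<longrightarrow> par_tm b d"
  "nf_co l \<Longrightarrow> \<exists>d. \<forall>b. par_co l b \<longrightarrow> par_co b d"
proof (induction t and l)
  case (Var x)
  then show ?case by (auto elim: par_VarE intro: par_tm_par_co.Var)
next
  case (Lam t)
  then obtain d where "\<forall>b. par_tm t b \<longrightarrow> par_tm b d" by auto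
  then show ?case
    by (intro exI[of _ "Lam d"]) (auto elim!: par_LamE intro: par_tm_par_co.Lam)
next
  case (App t l)
  then obtain d m where d: "\<And>b. par_tm t b \<Longrightarrow> par_tm b d" and m: "\<And>b. par_co l b \<Longrightarrow> par_co b m"
    by auto
  have nf: "nf_tm t" "nf_co l" "is_Cons l" "is_val t" using App.prems by auto
  obtain u l1 where l: "l = Cons u l1" using nf by (cases l) auto
  show ?case
  proof (cases t)
    case (Var x)
    then show ?thesis
      using d m nf
      by (intro exI[of _ "App d m"])
        (auto elim!: par_AppE intro!: par_tm_par_co.App simp: par_is_Cons par_is_val)
  next
    case (Lam a)
    \<comment> \<open>The induction hypotheses concern only \<open>t\<close> and \<open>l\<close>,
      so maximal reducts of their components are extracted from \<open>d\<close> and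
      \<open>m\<close>, whose shapes follow by reflexivity.\<close>
    obtain a' where d': "d = Lam a'"
      using d[OF par_refl(1)[OF nf(1)]] Lam by (auto elim: par_LamE)
    obtain u' l' where m': "m = Cons u' l'"
      using m[OF par_refl(2)[OF nf(2)]] l by (auto elim: par_ConsE)
    have a: "par_tm b a'" if "par_tm a b" for b
      using d[of "Lam b"] that Lam d' by (auto intro: par_tm_par_co.Lam elim: par_LamE)
    have u: "par_tm b u' \<and> par_co n l'" if "par_tm u b" "par_co l1 n" for b n
      using m[of "Cons b n"] that l m' by (auto intro: par_tm_par_co.Cons elim: par_ConsE)
    \<comment> \<open>A reduct that kept the redex gets here by \<beta>; one that contracted it, by
      compatibility with substitution and \<open>nf_app\<close>.\<close>
    have "par_tm b (nf_app (flat_subst_tm a' u' 0) l')" if "par_tm (App (Lam a) (Cons u l1)) b" for b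
      using that
      by (auto elim!: par_AppE par_LamE par_ConsE dest: a u
          intro!: par_tm_par_co.beta par_nf_app par_flat_subst)
    then show ?thesis using Lam l by blast
  qed (use nf in auto)
next
  case (Cons u l)
  then obtain d m where "\<forall>b. par_tm u b \<longrightarrow> par_tm b d" "\<forall>b. par_co l b \<longrightarrow> par_co b m"
    by auto
  then show ?case
    by (intro exI[of _ "Cons d m"]) (auto elim!: par_ConsE intro: par_tm_par_co.Cons)
next
  case (Sel v)
  then obtain d where d: "\<And>b. par_tm v b \<Longrightarrow> par_tm b d" by auto
  have nf: "nf_tm v" using Sel.prems by simp
  show ?case
  proof (cases "\<exists>l. v = App (Var 0) (lift_co l 0)")
    case False
    then show ?thesis
      using d by (intro exI[of _ "Sel d"]) (auto elim!: par_SelE intro: par_tm_par_co.Sel)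
  next
    case True
    then obtain l where v: "v = App (Var 0) (lift_co l 0)" by auto
    have l: "is_Cons l" "nf_co l" using nf v by auto
    have step: "\<exists>l'. b = App (Var 0) (lift_co l' 0) \<and> par_co l l'"
      if "par_tm (App (Var 0) (lift_co l 0)) b" for b l
      using that by (auto elim!: par_AppE par_VarE dest: par_lift_left(2)[OF _ refl])
    obtain m where m: "d = App (Var 0) (lift_co m 0)"
      using step d par_refl(1)[OF nf] v by blast
    have l': "par_co l' m" if "par_co l l'" for l'
    proof -
      have "par_tm v (App (Var 0) (lift_co l' 0))"
        using that l v by (auto intro: par_tm_par_co.intros par_lift)
      then obtain m' where "d = App (Var 0) (lift_co m' 0)" "par_co l' m'"
        using step d by blast
      with m show ?thesis using lift_inject(2) by auto
    qed
    have "par_co b m" if "par_co (Sel v) b" for b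
      using that
    proof cases
      case (Sel v')
      then obtain l1 where "v' = App (Var 0) (lift_co l1 0)" "par_co l l1"
        using step v by blast
      with Sel l l' show ?thesis
        by (auto intro!: par_tm_par_co.mu dest: par_is_Cons)
    next
      case (mu l1)
      then show ?thesis using v l' lift_inject(2) by auto
    qed
    then show ?thesis by blast
  qed
qed

section \<open>Simulation in both directions\<close>

lemma red_norm:
  "red_tm t t' \<Longrightarrow> par_tm (norm_tm t) (norm_tm t')"
  "red_co l l' \<Longrightarrow> par_co (norm_co l) (norm_co l')"
proof (induction rule: red_tm_red_co.inducts)
  case (beta t u l)
  \<comment> \<open>The substitution undoes the lifting of \<open>norm_co l\<close>, so the normal
    form of the contractum is exactly the parallel \<beta>-reduct.\<close>
  show ?case
    by (auto simp: norm_lift flat_subst_nf_app flat_subst_lift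
        intro!: par_tm_par_co.beta par_refl)
next
  case (sigma t v)
  show ?case by (auto simp: norm_subst intro!: par_refl nf_flat_subst)
next
  case (pi t l u l')
  have "norm_tm (App t (append_co l (Cons u l'))) = norm_tm (App (App t l) (Cons u l'))"
    by (simp add: norm_flat_app_append nf_app_append)
  then show ?case using par_refl(1)[OF nf_norm(1)] by metis
next
  case (mu l)
  \<comment> \<open>Only a \<open>Cons\<close> leaves a \<mu>-redex in the normal form. For a
    \<open>Sel\<close> the body is a \<sigma>-redex, and normalisation contracts it to the same
    result.\<close>
  show ?case
  proof (cases l)
    case (Cons u m)
    then have "par_co (Sel (App (Var 0) (lift_co (norm_co l) 0))) (norm_co l)"
      by (intro par_tm_par_co.mu) (auto intro!: par_refl)
    with Cons show ?thesis by (auto simp: norm_lift)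
  next
    case (Sel v)
    then show ?thesis by (auto simp: norm_lift flat_subst_Var_lift intro!: par_refl)
  qed
qed (auto intro!: par_tm_par_co.intros par_nf_app par_refl)

section \<open>Many-step reduction realises normalisation and parallel reduction\<close>

lemma reds_Lam: "red_tm\<^sup>*\<^sup>* t t' \<Longrightarrow> red_tm\<^sup>*\<^sup>* (Lam t) (Lam t')"
  by (induction rule: rtranclp_induct) (auto intro: rtranclp.rtrancl_into_rtrancl red_tm_red_co.Lam)

lemma reds_App1: "red_tm\<^sup>*\<^sup>* t t' \<Longrightarrow> red_tm\<^sup>*\<^sup>* (App t l) (App t' l)"
  by (induction rule: rtranclp_induct) (auto intro: rtranclp.rtrancl_into_rtrancl red_tm_red_co.App1)

lemma reds_App2: "red_co\<^sup>*\<^sup>* l l' \<Longrightarrow> red_tm\<^sup>*\<^sup>* (App t l) (App t l')"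
  by (induction rule: rtranclp_induct) (auto intro: rtranclp.rtrancl_into_rtrancl red_tm_red_co.App2)

lemma reds_App: "red_tm\<^sup>*\<^sup>* t t' \<Longrightarrow> red_co\<^sup>*\<^sup>* l l' \<Longrightarrow> red_tm\<^sup>*\<^sup>* (App t l) (App t' l')"
  using reds_App1 reds_App2 by (meson rtranclp_trans)

lemma reds_Cons1: "red_tm\<^sup>*\<^sup>* u u' \<Longrightarrow> red_co\<^sup>*\<^sup>* (Cons u l) (Cons u' l)"
  by (induction rule: rtranclp_induct) (auto intro: rtranclp.rtrancl_into_rtrancl red_tm_red_co.Cons1)

lemma reds_Cons2: "red_co\<^sup>*\<^sup>* l l' \<Longrightarrow> red_co\<^sup>*\<^sup>* (Cons u l) (Cons u l')"
  by (induction rule: rtranclp_induct) (auto intro: rtranclp.rtrancl_into_rtrancl red_tm_red_co.Cons2)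

lemma reds_Cons: "red_tm\<^sup>*\<^sup>* u u' \<Longrightarrow> red_co\<^sup>*\<^sup>* l l' \<Longrightarrow> red_co\<^sup>*\<^sup>* (Cons u l) (Cons u' l')"
  using reds_Cons1 reds_Cons2 by (meson rtranclp_trans)

lemma reds_Sel: "red_tm\<^sup>*\<^sup>* v v' \<Longrightarrow> red_co\<^sup>*\<^sup>* (Sel v) (Sel v')"
  by (induction rule: rtranclp_induct) (auto intro: rtranclp.rtrancl_into_rtrancl red_tm_red_co.Sel)

lemma reds_flat_app: "is_Cons l \<Longrightarrow> red_tm\<^sup>*\<^sup>* (App t l) (flat_app t l)"
  by (cases t; cases l) (auto intro: red_tm_red_co.pi)

text \<open>In a normal form every argument of an application is a \<open>Cons\<close>, also after
  substitution, so each flattening is at most one \<pi>-step.\<close>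

lemma reds_flat_subst:
  "nf_tm t \<Longrightarrow> red_tm\<^sup>*\<^sup>* (subst_tm t s k) (flat_subst_tm t s k)"
  "nf_co l \<Longrightarrow> red_co\<^sup>*\<^sup>* (subst_co l s k) (flat_subst_co l s k)"
proof (induction t and l arbitrary: s k and s k)
  case (App t l)
  then have "red_tm\<^sup>*\<^sup>* (subst_tm (App t l) s k) (App (flat_subst_tm t s k) (flat_subst_co l s k))"
    by (auto intro: reds_App)
  also have "red_tm\<^sup>*\<^sup>* \<dots> (flat_subst_tm (App t l) s k)"
    using App.prems by (auto intro: reds_flat_app)
  finally show ?case .
qed (auto intro: reds_Lam reds_Cons reds_Sel)

lemma reds_nf_app: "nf_co l \<Longrightarrow> red_tm\<^sup>*\<^sup>* (App t l) (nf_app t l)"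
proof (cases l)
  case (Sel v)
  assume "nf_co l"
  then have "red_tm\<^sup>*\<^sup>* (subst_tm v t 0) (flat_subst_tm v t 0)"
    using Sel by (auto intro: reds_flat_subst)
  with Sel show ?thesis
    by (auto intro: converse_rtranclp_into_rtranclp red_tm_red_co.sigma)
qed (use reds_flat_app[of l t] in auto)

lemma reds_norm: "red_tm\<^sup>*\<^sup>* t (norm_tm t)" "red_co\<^sup>*\<^sup>* l (norm_co l)"
proof (induction t and l)
  case (App t l)
  then have "red_tm\<^sup>*\<^sup>* (App t l) (App (norm_tm t) (norm_co l))" by (rule reds_App)
  also have "red_tm\<^sup>*\<^sup>* \<dots> (norm_tm (App t l))" by (auto intro: reds_nf_app)
  finally show ?case .
qed (auto intro: reds_Lam reds_Cons reds_Sel)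

lemma subst_lift:
  "subst_tm (lift_tm t k) s k = t"
  "subst_co (lift_co l k) s k = l"
  by (induction t and l arbitrary: s k and s k) auto

lemma par_reds:
  "par_tm t t' \<Longrightarrow> red_tm\<^sup>*\<^sup>* t t'"
  "par_co l l' \<Longrightarrow> red_co\<^sup>*\<^sup>* l l'"
proof (induction rule: par_tm_par_co.inducts)
  case (beta t t' u u' l l')
  have nf: "nf_tm t'" "nf_co l'" using beta.hyps par_nf by auto
  have "red_tm\<^sup>*\<^sup>* (App (Lam t) (Cons u l)) (App (Lam t') (Cons u' l'))"
    using beta by (intro reds_App reds_Lam reds_Cons)
  also have "red_tm \<dots> (App u' (Sel (App t' (lift_co l' 0))))"
    by (rule red_tm_red_co.beta)
  \<comment> \<open>The bound variable is absent from the lifted \<open>l'\<close>, so \<sigma> acts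
    on \<open>t'\<close> only and undoes the lifting.\<close>
  also have "red_tm \<dots> (App (subst_tm t' u' 0) l')"
    using red_tm_red_co.sigma[of u' "App t' (lift_co l' 0)"] by (simp add: subst_lift)
  also have "red_tm\<^sup>*\<^sup>* \<dots> (App (flat_subst_tm t' u' 0) l')"
    using nf by (intro reds_App1 reds_flat_subst)
  also have "red_tm\<^sup>*\<^sup>* \<dots> (nf_app (flat_subst_tm t' u' 0) l')"
    using nf by (intro reds_nf_app)
  finally show ?case .
next
  case (mu l l')
  then show ?case by (meson converse_rtranclp_into_rtranclp red_tm_red_co.mu)
qed (auto intro: reds_Lam reds_App reds_Cons reds_Sel)

text \<open>A peak of \<open>R\<close> maps under \<open>N\<close> to a peak of \<open>P\<close>,
  which the diamond property closes; \<open>norm\<close> followed by \<open>sound\<close> turns this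
  into a join for \<open>R\<close>.\<close>

lemma confluentp_interpretation:
  assumes sim: "\<And>a b. R a b \<Longrightarrow> P (N a) (N b)"
    and norm: "\<And>a. R\<^sup>*\<^sup>* a (N a)"
    and sound: "\<And>a b. P a b \<Longrightarrow> R\<^sup>*\<^sup>* a b"
    and diamond: "\<And>a b c. P a b \<Longrightarrow> P a c \<Longrightarrow> \<exists>d. P b d \<and> P c d"
  shows "confluentp R"
proof (rule confluentpI)
  have sims: "P\<^sup>*\<^sup>* (N a) (N b)" if "R\<^sup>*\<^sup>* a b" for a b
    using that by induction (simp, metis sim rtranclp.rtrancl_into_rtrancl)
  have backs: "R\<^sup>*\<^sup>* a b" if "P\<^sup>*\<^sup>* a b" for a b
    using that by induction (simp, metis sound rtranclp_trans)
  have "confluentp P"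
    by (intro strong_confluentp_imp_confluentp strong_confluentpI) (use diamond in blast)
  fix a b c
  assume "R\<^sup>*\<^sup>* a b" "R\<^sup>*\<^sup>* a c"
  then obtain d where "P\<^sup>*\<^sup>* (N b) d" "P\<^sup>*\<^sup>* (N c) d"
    using confluentpD[OF \<open>confluentp P\<close> sims sims] by blast
  then have "R\<^sup>*\<^sup>* b d" "R\<^sup>*\<^sup>* c d"
    using rtranclp_trans[OF norm backs] by blast+
  then show "\<exists>d. R\<^sup>*\<^sup>* b d \<and> R\<^sup>*\<^sup>* c d"
    by blast
qed

theorem theorem3p5:
  "confluentp red_tm \<and> confluentp red_co"
proof
  show "confluentp red_tm"
  proof (rule confluentp_interpretation)
    \<comment> \<open>The triangle property asks for a normal \<open>a\<close>; the source of any
      parallel step is normal.\<close>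
    show "\<exists>d. par_tm b d \<and> par_tm c d" if "par_tm a b" "par_tm a c" for a b c
      using par_triangle(1)[of a] par_nf(1)[OF that(1)] that by blast
  qed (fact red_norm reds_norm par_reds)+
  show "confluentp red_co"
  proof (rule confluentp_interpretation)
    show "\<exists>d. par_co b d \<and> par_co c d" if "par_co a b" "par_co a c" for a b c
      using par_triangle(2)[of a] par_nf(2)[OF that(1)] that by blast
  qed (fact red_norm reds_norm par_reds)+
qed

end
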